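(* Let $\delta>0$ and let $q\in L^\infty(-\infty,t_0)$ for some $t_0\in\mathbb{R}$. Assume that: - there exists $\eta>0$ for which $q(t)\ge\eta$ for almost every $t\in\,]-\infty,t_0[$; - there exists $c>0$ for which $q\equiv c$ in $[t_0,+\infty[$. Let $f\colon[0,1]\to\mathbb{R}$ be a Lipschitz continuous function such that $f(0)=f(1)=0$ and there exists $\alpha\in\,]0,1[$ with $f(\alpha)=0$, $f(s)<0$ for all $s\in\,]0,\alpha[$ and $f(s)>0$ for all $s\in\,]\alpha,1[$. Let $F(v)=\int_0^v f(s)\,\mathrm{d}s$ and assume $F(1)>0$. If $$\eta>\|q\|_{L^\infty(-\infty,t_0)}\,\frac{-F(\alpha)}{F(1)-F(\alpha)}\qquad\text{and}\qquad c>\|q\|_{L^\infty(-\infty,t_0)}\,\frac{-F(\alpha)}{F(1)-F(\alpha)},$$ then no heteroclinic solutions of $$\delta\bigl(\phi(v'(t))\bigr)'+q(t)f(v(t))=0,\quad t\in\mathbb{R},$$ exist.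
   Context: $\phi(\xi)=\dfrac{\xi}{\sqrt{1-\xi^2}}$ for $\xi\in\,]-1,1[$. A solution is a continuously differentiable function $v\colon\mathbb{R}\to[0,1]$, with $v'$ absolutely continuous, which satisfies the equation almost everywhere. A heteroclinic solution is a solution $v$ which is strictly increasing with $\lim_{t\to-\infty}v(t)=0$ and $\lim_{t\to+\infty}v(t)=1$. *)

theory Defs
  imports "HOL-Analysis.Analysis" "HOL-Probability.Essential_Supremum"
begin

text \<open>Only the values on \<open>{-1<..<1}\<close> are meaningful.\<close>

definition mink_phi :: "real \<Rightarrow> real" where
  "mink_phi \<xi> = \<xi> / sqrt (1 - \<xi>\<^sup>2)"

definition in_Linf :: "'a measure \<Rightarrow> ('a \<Rightarrow> real) \<Rightarrow> bool" where
  "in_Linf M g \<longleftrightarrow> g \<in> borel_measurable M \<and> esssup M (\<lambda>x. ereal \<bar>g x\<bar>) < \<infinity>"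

definition Linf_norm :: "'a measure \<Rightarrow> ('a \<Rightarrow> real) \<Rightarrow> real" where
  "Linf_norm M g = real_of_ereal (esssup M (\<lambda>x. ereal \<bar>g x\<bar>))"

text \<open>Absolute continuity on an interval \<open>S\<close>; a pair \<open>(a, b)\<close> in \<open>D\<close> encodes the
  interval with these end points.\<close>

definition abs_continuous_on :: "real set \<Rightarrow> (real \<Rightarrow> real) \<Rightarrow> bool" where
  "abs_continuous_on S g \<longleftrightarrow>
     (\<forall>\<epsilon>>0. \<exists>\<rho>>0. \<forall>D. finite D
        \<and> (\<forall>(a, b)\<in>D. a \<le> b \<and> {a..b} \<subseteq> S)
        \<and> pairwise (\<lambda>(a, b) (c, d). {a<..<b} \<inter> {c<..<d} = {}) D
        \<and> (\<Sum>(a, b)\<in>D. b - a) < \<rho>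
        \<longrightarrow> (\<Sum>(a, b)\<in>D. \<bar>g b - g a\<bar>) < \<epsilon>)"

text \<open>On the whole real line, absolute continuity is understood locally, i.e. on every compact
  interval. This makes the class of solutions as large as possible.\<close>

definition locally_abs_continuous :: "(real \<Rightarrow> real) \<Rightarrow> bool" where
  "locally_abs_continuous g \<longleftrightarrow> (\<forall>a b. abs_continuous_on {a..b} g)"

text \<open>Solutions of \<open>\<delta> (\<phi>(v'))' + q f(v) = 0\<close>. The condition \<open>\<bar>v'\<bar> < 1\<close> says that \<open>\<phi>(v')\<close> is
  defined. As \<^const>\<open>deriv\<close> is total, the differentiability of \<open>\<phi>(v')\<close> at almost every point
  has to be part of the equation.\<close>

definition is_solution ::
  "real \<Rightarrow> (real \<Rightarrow> real) \<Rightarrow> (real \<Rightarrow> real) \<Rightarrow> (real \<Rightarrow> real) \<Rightarrow> bool" where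
  "is_solution \<delta> q f v \<longleftrightarrow>
     (\<forall>t. v t \<in> {0..1}) \<and>
     v C1_differentiable_on UNIV \<and>
     locally_abs_continuous (deriv v) \<and>
     (\<forall>t. \<bar>deriv v t\<bar> < 1) \<and>
     (AE t in lebesgue.
        (\<lambda>s. mink_phi (deriv v s)) field_differentiable (at t) \<and>
        \<delta> * deriv (\<lambda>s. mink_phi (deriv v s)) t + q t * f (v t) = 0)"

definition heteroclinic_solution ::
  "real \<Rightarrow> (real \<Rightarrow> real) \<Rightarrow> (real \<Rightarrow> real) \<Rightarrow> (real \<Rightarrow> real) \<Rightarrow> bool" where
  "heteroclinic_solution \<delta> q f v \<longleftrightarrow>
     is_solution \<delta> q f v \<and> strict_mono v \<and>
     (v \<longlongrightarrow> 0) at_bot \<and> (v \<longlongrightarrow> 1) at_top"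

text \<open>Meaningful for \<open>v \<ge> 0\<close> only.\<close>

definition primitive :: "(real \<Rightarrow> real) \<Rightarrow> real \<Rightarrow> real" where
  "primitive f v = integral {0..v} f"

end

theory Submission
  imports Defs
begin

text \<open>For a constant \<open>K\<close> the energy \<open>H\<^sub>K = \<delta> / sqrt (1 - v'\<^sup>2) + K F(v)\<close> is absolutely continuous,
  and \<open>H\<^sub>K' = f(v) (K - q) v'\<close> almost everywhere. Let \<open>M\<close> be the norm of \<open>q\<close>.
  As \<open>v' \<ge> 0\<close>, the energy decreases on \<open>[t\<^sub>0, \<infinity>)\<close> for \<open>K = c\<close>, as long as \<open>v \<le> \<alpha>\<close> on the left of \<open>t\<^sub>0\<close>
  for \<open>K = M\<close>, and once \<open>v \<ge> \<alpha>\<close> on the left of \<open>t\<^sub>0\<close> for \<open>K = \<eta>\<close>. Comparing the kinetic energy at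
  \<open>t\<^sub>0\<close> obtained from both ends gives
  \<open>c (F(1) - F(v(t\<^sub>0))) \<le> - M F(v(t\<^sub>0))\<close> if \<open>v(t\<^sub>0) \<le> \<alpha>\<close>, and
  \<open>c (F(1) - F(v(t\<^sub>0))) + \<eta> (F(v(t\<^sub>0)) - F(\<alpha>)) \<le> - M F(\<alpha>)\<close> otherwise; both contradict the bounds
  on \<open>\<eta>\<close> and \<open>c\<close>.\<close>

subsection \<open>Absolutely continuous functions\<close>

text \<open>The linear approximation errors at the two end points add up to at most
  \<open>\<epsilon> * ((z - t) + (t - y))\<close>, which equals \<open>\<epsilon> * (z - y)\<close>
  because \<open>t\<close> lies between them. The bound thus scales with the length of any small
  interval containing its tag.\<close>

lemma has_real_derivative_nonpos_straddle:
  fixes g :: "real \<Rightarrow> real"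
  assumes "(g has_real_derivative D) (at t)" "D \<le> 0" "\<epsilon> > 0"
  shows "\<exists>d>0. \<forall>y z. t - d < y \<and> y \<le> t \<and> t \<le> z \<and> z < t + d \<longrightarrow> g z - g y \<le> \<epsilon> * (z - y)"
proof -
  have "(g has_derivative (\<lambda>h. D * h)) (at t)"
    using assms(1) by (simp add: has_field_derivative_def)
  then obtain d where d: "d > 0"
    "\<And>y. \<bar>y - t\<bar> < d \<Longrightarrow> \<bar>g y - g t - D * (y - t)\<bar> \<le> \<epsilon> * \<bar>y - t\<bar>"
    using \<open>\<epsilon> > 0\<close> unfolding has_derivative_at_alt real_norm_def by blast
  have "g z - g y \<le> \<epsilon> * (z - y)" if "t - d < y" "y \<le> t" "t \<le> z" "z < t + d" for y z
  proof -
    have "g z - g t - D * (z - t) \<le> \<epsilon> * (z - t)" "- (g y - g t - D * (y - t)) \<le> \<epsilon> * (t - y)"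
      using d(2)[of z] d(2)[of y] that by (simp_all add: abs_le_iff)
    moreover have "D * (z - y) \<le> 0"
      using that assms(2) by (intro mult_nonpos_nonneg) auto
    ultimately show ?thesis by (simp add: algebra_simps)
  qed
  then show ?thesis using d(1) by blast
qed

text \<open>Carries absolute continuity from families of end point pairs over to tagged divisions.
  The intervals do not overlap, so their total length is the measure of their union, which lies in
  \<open>U\<close>.\<close>

lemma abs_continuous_on_tagged_division_small:
  assumes ac: "abs_continuous_on {a..b} g" and "\<epsilon> > 0"
  obtains \<rho> where "\<rho> > 0"
    "\<And>B U. B tagged_partial_division_of {a..b} \<Longrightarrow> U \<in> lmeasurable \<Longrightarrow> measure lebesgue U < \<rho> \<Longrightarrow>
       (\<And>x K. (x, K) \<in> B \<Longrightarrow> K \<subseteq> U) \<Longrightarrow>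
       (\<Sum>(x, K)\<in>B. \<bar>g (Sup K) - g (Inf K)\<bar>) < \<epsilon>"
proof -
  obtain \<rho> where "\<rho> > 0" and \<rho>: "\<And>D. finite D \<and> (\<forall>(a', b')\<in>D. a' \<le> b' \<and> {a'..b'} \<subseteq> {a..b})
        \<and> pairwise (\<lambda>(a, b) (c, d). {a<..<b} \<inter> {c<..<d} = {}) D
        \<and> (\<Sum>(a, b)\<in>D. b - a) < \<rho> \<Longrightarrow> (\<Sum>(a, b)\<in>D. \<bar>g b - g a\<bar>) < \<epsilon>"
    using ac[unfolded abs_continuous_on_def, rule_format, OF \<open>\<epsilon> > 0\<close>] by blast
  show thesis
  proof (rule that[OF \<open>\<rho> > 0\<close>])
    fix B U assume B: "B tagged_partial_division_of {a..b}" and U: "U \<in> lmeasurable"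
      "measure lebesgue U < \<rho>" and BU: "\<And>x K. (x, K) \<in> B \<Longrightarrow> K \<subseteq> U"
    note BD = tagged_partial_division_ofD[OF B]
    define e where "e = (\<lambda>(x::real, K::real set). (Inf K, Sup K))"
    have K: "Inf K \<le> Sup K \<and> K = {Inf K..Sup K} \<and> K \<subseteq> {a..b}" if xK: "(x, K) \<in> B" for x K
    proof -
      obtain c d where cd: "K = cbox c d" using BD(4)[OF xK] by blast
      moreover have "x \<in> K" using BD(2)[OF xK] .
      ultimately show ?thesis using BD(3)[OF xK] by auto
    qed
    have disj: "{Inf K<..<Sup K} \<inter> {Inf L<..<Sup L} = {}"
      if "(x, K) \<in> B" "(y, L) \<in> B" "(x, K) \<noteq> (y, L)" for x K y L
      using BD(5)[OF that] K[OF that(1)] K[OF that(2)] by (metis interior_atLeastAtMost_real)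
    \<comment> \<open>\<open>e\<close> forgets the tags and need not be injective. Distinct pairs
      with the same end points have disjoint interiors, so their common interval is a single point
      and contributes \<open>h s s = 0\<close>.\<close>
    have sums: "(\<Sum>(s, t)\<in>e ` B. h s t) = (\<Sum>(x, K)\<in>B. h (Inf K) (Sup K))"
      if h: "\<And>s. h s s = 0" for h :: "real \<Rightarrow> real \<Rightarrow> real"
    proof -
      have "(\<Sum>(s, t)\<in>e ` B. h s t) = sum ((\<lambda>(s, t). h s t) \<circ> e) B"
      proof (rule sum.reindex_nontrivial[OF BD(1)])
        fix p r assume pr: "p \<in> B" "r \<in> B" "p \<noteq> r" "e p = e r"
        obtain x K y L where [simp]: "p = (x, K)" "r = (y, L)" by (metis surj_pair)
        have "{Inf K<..<Sup K} = {}" "Inf K \<le> Sup K"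
          using disj[of x K y L] pr K[of x K] by (auto simp: e_def)
        then have "Inf K = Sup K" by (simp add: greaterThanLessThan_empty_iff)
        then show "(case e p of (s, t) \<Rightarrow> h s t) = 0" by (simp add: e_def h)
      qed
      then show ?thesis by (simp add: e_def case_prod_unfold o_def)
    qed
    have BU': "\<Union> (snd ` B) \<subseteq> U"
      using BU by fastforce
    have div: "snd ` B division_of \<Union> (snd ` B)"
      using partial_division_of_tagged_division[OF B] .
    have "(\<Sum>(x, K)\<in>B. Sup K - Inf K) = (\<Sum>(x, K)\<in>B. measure lborel K)"
    proof (rule sum.cong, safe)
      fix x K assume "(x, K) \<in> B"
      from K[OF this] show "Sup K - Inf K = measure lborel K" by (metis content_real)
    qed
    \<comment> \<open>An interval that carries several tags has empty interior, hence content 0, so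
      dropping the tags preserves the sum.\<close>
    also have "\<dots> = (\<Sum>K\<in>snd ` B. measure lborel K)"
      by (rule sum.over_tagged_division_lemma[OF tagged_partial_division_of_Union_self[OF B]])
         (simp add: content_eq_0_interior)
    also have "\<dots> = measure lebesgue (\<Union> (snd ` B))"
    proof -
      have "(\<Sum>K\<in>snd ` B. measure lborel K) = (\<Sum>K\<in>snd ` B. measure lebesgue K)"
      proof (rule sum.cong[OF refl])
        fix K assume "K \<in> snd ` B"
        then obtain c d where "K = cbox c d" using division_ofD(4)[OF div] by blast
        then show "measure lborel K = measure lebesgue K" by (simp add: measure_completion)
      qed
      then show ?thesis using content_division[OF div] by simp
    qed
    also have "\<dots> \<le> measure lebesgue U"
      using lmeasurable_division[OF div] by (intro measure_mono_fmeasurable BU' U fmeasurableD)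
    finally have "(\<Sum>(s, t)\<in>e ` B. t - s) < \<rho>" using U by (simp add: sums)
    moreover have "pairwise (\<lambda>(a, b) (c, d). {a<..<b} \<inter> {c<..<d} = {}) (e ` B)"
      unfolding pairwise_def using disj by (fastforce simp: e_def)
    moreover have "\<forall>(a', b')\<in>e ` B. a' \<le> b' \<and> {a'..b'} \<subseteq> {a..b}"
      using K by (fastforce simp: e_def)
    ultimately have "(\<Sum>(s, t)\<in>e ` B. \<bar>g t - g s\<bar>) < \<epsilon>"
      using BD(1) by (intro \<rho>) auto
    then show "(\<Sum>(x, K)\<in>B. \<bar>g (Sup K) - g (Inf K)\<bar>) < \<epsilon>" by (simp add: sums)
  qed
qed

text \<open>Cousin's lemma replaces the fundamental theorem of calculus: in a fine tagged division the
  intervals tagged in the exceptional null set lie in a small open set.\<close>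

lemma abs_continuous_on_AE_nonpos_deriv_imp_le:
  assumes ac: "abs_continuous_on {a..b} g" and ab: "a \<le> b"
    and der: "AE t in lebesgue. t \<in> {a<..<b} \<longrightarrow> (\<exists>D\<le>0. (g has_real_derivative D) (at t))"
  shows "g b \<le> g a"
proof (rule field_le_epsilon)
  fix e :: real assume e: "e > 0"
  \<comment> \<open>The error budget is \<open>\<epsilon> * (b - a)\<close> for the intervals with
    good tags and \<open>\<epsilon>\<close> for those tagged in the null set. The summand 1 keeps
    the denominator positive when \<open>a = b\<close>.\<close>
  define \<epsilon> where "\<epsilon> = e / (b - a + 1)"
  have \<epsilon>: "\<epsilon> > 0" "\<epsilon> * (b - a) + \<epsilon> = e"
  proof -
    show "\<epsilon> > 0" using e ab by (simp add: \<epsilon>_def)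
    have "\<epsilon> * (b - a + 1) = e" using ab by (simp add: \<epsilon>_def)
    then show "\<epsilon> * (b - a) + \<epsilon> = e" by (simp add: algebra_simps)
  qed
  obtain \<rho> where "\<rho> > 0" and \<rho>:
    "\<And>B U. B tagged_partial_division_of {a..b} \<Longrightarrow> U \<in> lmeasurable \<Longrightarrow> measure lebesgue U < \<rho> \<Longrightarrow>
       (\<And>x K. (x, K) \<in> B \<Longrightarrow> K \<subseteq> U) \<Longrightarrow>
       (\<Sum>(x, K)\<in>B. \<bar>g (Sup K) - g (Inf K)\<bar>) < \<epsilon>"
    using abs_continuous_on_tagged_division_small[OF ac \<epsilon>(1)] by blast
  obtain N' where N':
    "\<And>t. t \<in> space lebesgue - N' \<Longrightarrow> t \<in> {a<..<b} \<longrightarrow> (\<exists>D\<le>0. (g has_real_derivative D) (at t))"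
    "N' \<in> null_sets lebesgue"
    by (rule AE_E3[OF der]) (rule that, assumption+)
  \<comment> \<open>The end points join the exceptional set, since derivatives are given only in the
    open interval.\<close>
  define N where "N = N' \<union> {a, b}"
  have N: "N \<in> null_sets lebesgue"
    unfolding N_def using N' by (intro null_sets.Un) (auto simp: negligible_iff_null_sets[symmetric])
  obtain U where U: "open U" "N \<subseteq> U" "U - N \<in> lmeasurable" "emeasure lebesgue (U - N) < ennreal \<rho>"
    using sets_lebesgue_outer_open[of N \<rho>] N \<open>\<rho> > 0\<close> by blast
  have U_meas: "U \<in> lmeasurable" "measure lebesgue U < \<rho>"
  proof -
    have eq: "U = (U - N) \<union> N" using U by auto
    show "U \<in> lmeasurable"
      using fmeasurable.Un[OF U(3), of N] eq N by (metis fmeasurableI_null_sets)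
    have "emeasure lebesgue U = emeasure lebesgue (U - N)"
      using eq by (metis N U(3) emeasure_Un_null_set fmeasurableD)
    then have "emeasure lebesgue U < ennreal \<rho>" using U by simp
    then have "ennreal (measure lebesgue U) < ennreal \<rho>"
      using \<open>U \<in> lmeasurable\<close> by (simp add: emeasure_eq_measure2)
    then show "measure lebesgue U < \<rho>" by (simp add: ennreal_less_iff)
  qed
  \<comment> \<open>Choice of the gauge: at an exceptional point the ball stays inside
    \<open>U\<close>; at any other point of the interval the radius comes from the straddle
    estimate; elsewhere it is arbitrary.\<close>
  have "\<exists>d>0. (t \<in> N \<longrightarrow> ball t d \<subseteq> U) \<and>
      (t \<in> {a..b} - N \<longrightarrow> (\<forall>y z. t - d < y \<and> y \<le> t \<and> t \<le> z \<and> z < t + d \<longrightarrow> g z - g y \<le> \<epsilon> * (z - y)))" for t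
  proof (cases "t \<in> N")
    case True
    then show ?thesis using U by (metis DiffD2 openE subsetD)
  next
    case False
    show ?thesis
    proof (cases "t \<in> {a..b}")
      case True
      with False N'(1)[of t] obtain D where "D \<le> 0" "(g has_real_derivative D) (at t)"
        by (auto simp: N_def)
      then show ?thesis
        using has_real_derivative_nonpos_straddle[of g D t \<epsilon>] \<epsilon> False by blast
    qed (use False in \<open>auto intro!: exI[of _ 1]\<close>)
  qed
  then obtain d where d: "\<And>t. d t > 0" "\<And>t. t \<in> N \<Longrightarrow> ball t (d t) \<subseteq> U"
    "\<And>t y z. t \<in> {a..b} - N \<Longrightarrow> t - d t < y \<Longrightarrow> y \<le> t \<Longrightarrow> t \<le> z \<Longrightarrow> z < t + d t \<Longrightarrow> g z - g y \<le> \<epsilon> * (z - y)"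
    by metis
  have "gauge (\<lambda>t. ball t (d t))" using d(1) by (intro gauge_ball_dependent) auto
  then obtain p where p: "p tagged_division_of {a..b}" and fine: "(\<lambda>t. ball t (d t)) fine p"
    using fine_division_exists_real by blast
  note pD = tagged_division_ofD[OF p]
  define B where "B = {(x, K) \<in> p. x \<in> N}"
  have Bp: "B \<subseteq> p" by (auto simp: B_def)
  have B: "B tagged_partial_division_of {a..b}"
    using p Bp by (meson tagged_division_of_def tagged_partial_division_subset)
  have bad: "(\<Sum>(x, K)\<in>B. \<bar>g (Sup K) - g (Inf K)\<bar>) < \<epsilon>"
  proof (rule \<rho>[OF B U_meas])
    fix x K assume "(x, K) \<in> B"
    then have "K \<subseteq> ball x (d x)" "ball x (d x) \<subseteq> U"
      using fineD[OF fine, of x K] d(2)[of x] by (auto simp: B_def)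
    then show "K \<subseteq> U" by (rule order_trans)
  qed
  have len: "(\<Sum>(x, K)\<in>p. Sup K - Inf K) = b - a"
    using additive_tagged_division_1[OF ab p, of "\<lambda>x. x"] by simp
  have "g b - g a = (\<Sum>(x, K)\<in>p. g (Sup K) - g (Inf K))"
    using additive_tagged_division_1[OF ab p, of g] by simp
  \<comment> \<open>The nonnegative length term is granted to every interval, bad ones included, so
    that it sums to \<open>\<epsilon> * (b - a)\<close> over the whole division.\<close>
  also have "\<dots> \<le> (\<Sum>(x, K)\<in>p. \<epsilon> * (Sup K - Inf K)
      + (if (x, K) \<in> B then \<bar>g (Sup K) - g (Inf K)\<bar> else 0))"
  proof (rule sum_mono, safe)
    fix x K assume xK: "(x, K) \<in> p"
    obtain l u where lu: "K = {l..u}" using pD(4)[OF xK] by auto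
    have x: "x \<in> K" "x \<in> {a..b}" using pD(2,3)[OF xK] by auto
    then have IS: "Inf K = l" "Sup K = u" "l \<le> x" "x \<le> u" using lu by auto
    show "g (Sup K) - g (Inf K) \<le> \<epsilon> * (Sup K - Inf K)
      + (if (x, K) \<in> B then \<bar>g (Sup K) - g (Inf K)\<bar> else 0)"
    proof (cases "x \<in> N")
      case True
      moreover have "0 \<le> \<epsilon> * (u - l)" using \<epsilon> IS by simp
      ultimately show ?thesis using xK by (auto simp: B_def IS)
    next
      case False
      have "K \<subseteq> ball x (d x)" using fine xK by (auto simp: fine_def)
      moreover have "l \<in> K" "u \<in> K" using lu IS by auto
      ultimately have "x - d x < l" "u < x + d x" by (auto simp: dist_real_def subset_iff abs_less_iff)
      then show ?thesis using d(3)[of x l u] False x IS by (auto simp: B_def)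
    qed
  qed
  also have "\<dots> = \<epsilon> * (b - a) + (\<Sum>(x, K)\<in>B. \<bar>g (Sup K) - g (Inf K)\<bar>)"
  proof -
    have "(\<Sum>(x, K)\<in>p. if (x, K) \<in> B then \<bar>g (Sup K) - g (Inf K)\<bar> else 0)
        = (\<Sum>(x, K)\<in>B. \<bar>g (Sup K) - g (Inf K)\<bar>)"
      using Bp pD(1) by (intro sum.mono_neutral_cong_right) auto
    then show ?thesis
      using len by (simp add: case_prod_unfold sum.distrib sum_distrib_left[symmetric])
  qed
  finally show "g b \<le> g a + e" using bad \<epsilon> by linarith
qed

section \<open>Closure properties of absolute continuity and Lipschitz criteria\<close>

lemma abs_continuous_on_ident: "abs_continuous_on S (\<lambda>x. x)"
  unfolding abs_continuous_on_def
proof (intro allI impI)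
  fix \<epsilon> :: real assume "\<epsilon> > 0"
  have "(\<Sum>(a, b)\<in>D. \<bar>b - a\<bar>) = (\<Sum>(a, b)\<in>D. b - a)"
    if "\<forall>(a, b)\<in>D. a \<le> b \<and> {a..b} \<subseteq> S" for D :: "(real \<times> real) set"
    using that by (intro sum.cong) auto
  with \<open>\<epsilon> > 0\<close> show "\<exists>\<rho>>0. \<forall>D. finite D \<and> (\<forall>(a, b)\<in>D. a \<le> b \<and> {a..b} \<subseteq> S) \<and>
      pairwise (\<lambda>(a, b) (c, d). {a<..<b} \<inter> {c<..<d} = {}) D \<and> (\<Sum>(a, b)\<in>D. b - a) < \<rho> \<longrightarrow>
      (\<Sum>(a, b)\<in>D. \<bar>b - a\<bar>) < \<epsilon>"
    by (intro exI[of _ \<epsilon>]) auto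
qed

lemma abs_continuous_on_lipschitz_compose:
  assumes g: "abs_continuous_on S g" and h: "L-lipschitz_on T h" and "g ` S \<subseteq> T"
  shows "abs_continuous_on S (\<lambda>x. h (g x))"
  unfolding abs_continuous_on_def
proof (intro allI impI)
  fix \<epsilon> :: real assume "\<epsilon> > 0"
  have L: "0 \<le> L" using h by (rule lipschitz_on_nonneg)
  \<comment> \<open>\<open>L + 1\<close> replaces \<open>L\<close> because the Lipschitz constant
    may be 0.\<close>
  then have "\<epsilon> / (L + 1) > 0" using \<open>\<epsilon> > 0\<close> by simp
  from g[unfolded abs_continuous_on_def, rule_format, OF this] obtain \<rho> where "\<rho> > 0"
    and \<rho>: "\<And>D. finite D \<and> (\<forall>(a, b)\<in>D. a \<le> b \<and> {a..b} \<subseteq> S)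
        \<and> pairwise (\<lambda>(a, b) (c, d). {a<..<b} \<inter> {c<..<d} = {}) D
        \<and> (\<Sum>(a, b)\<in>D. b - a) < \<rho> \<Longrightarrow> (\<Sum>(a, b)\<in>D. \<bar>g b - g a\<bar>) < \<epsilon> / (L + 1)"
    by blast
  have "(\<Sum>(a, b)\<in>D. \<bar>h (g b) - h (g a)\<bar>) < \<epsilon>"
    if D: "finite D \<and> (\<forall>(a, b)\<in>D. a \<le> b \<and> {a..b} \<subseteq> S)
        \<and> pairwise (\<lambda>(a, b) (c, d). {a<..<b} \<inter> {c<..<d} = {}) D
        \<and> (\<Sum>(a, b)\<in>D. b - a) < \<rho>" for D
  proof -
    have "(\<Sum>(a, b)\<in>D. \<bar>h (g b) - h (g a)\<bar>) \<le> (\<Sum>(a, b)\<in>D. (L + 1) * \<bar>g b - g a\<bar>)"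
    proof (rule sum_mono, safe)
      fix a b assume "(a, b) \<in> D"
      then have "a \<le> b" "{a..b} \<subseteq> S" using D by auto
      then have "a \<in> S" "b \<in> S" by auto
      then have "g a \<in> T" "g b \<in> T" using \<open>g ` S \<subseteq> T\<close> by auto
      then have "\<bar>h (g b) - h (g a)\<bar> \<le> L * \<bar>g b - g a\<bar>"
        using lipschitz_onD[OF h] by (simp add: dist_real_def)
      then show "\<bar>h (g b) - h (g a)\<bar> \<le> (L + 1) * \<bar>g b - g a\<bar>"
        by (simp add: distrib_right)
    qed
    also have "\<dots> = (L + 1) * (\<Sum>(a, b)\<in>D. \<bar>g b - g a\<bar>)"
      by (simp add: sum_distrib_left case_prod_unfold)
    also have "\<dots> < (L + 1) * (\<epsilon> / (L + 1))"
      using \<rho>[OF D] L by (intro mult_strict_left_mono) auto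
    finally show ?thesis using L by simp
  qed
  with \<open>\<rho> > 0\<close> show "\<exists>\<rho>>0. \<forall>D. finite D \<and> (\<forall>(a, b)\<in>D. a \<le> b \<and> {a..b} \<subseteq> S) \<and>
      pairwise (\<lambda>(a, b) (c, d). {a<..<b} \<inter> {c<..<d} = {}) D \<and> (\<Sum>(a, b)\<in>D. b - a) < \<rho> \<longrightarrow>
      (\<Sum>(a, b)\<in>D. \<bar>h (g b) - h (g a)\<bar>) < \<epsilon>"
    by blast
qed

lemma lipschitz_imp_abs_continuous_on:
  assumes "L-lipschitz_on S g"
  shows "abs_continuous_on S g"
  using abs_continuous_on_lipschitz_compose[OF abs_continuous_on_ident assms] by simp

lemma abs_continuous_on_add:
  assumes g: "abs_continuous_on S g" and h: "abs_continuous_on S h"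
  shows "abs_continuous_on S (\<lambda>x. g x + h x)"
  unfolding abs_continuous_on_def
proof (intro allI impI)
  fix \<epsilon> :: real assume "\<epsilon> > 0"
  then have e: "\<epsilon> / 2 > 0" by simp
  let ?P = "\<lambda>D \<rho>. finite D \<and> (\<forall>(a, b)\<in>D. a \<le> b \<and> {a..b} \<subseteq> S)
        \<and> pairwise (\<lambda>(a, b) (c, d). {a<..<b} \<inter> {c<..<d} = {}) D \<and> (\<Sum>(a, b)\<in>D. b - a) < \<rho>"
  obtain \<rho>1 where \<rho>1: "\<rho>1 > 0" "\<And>D. ?P D \<rho>1 \<Longrightarrow> (\<Sum>(a, b)\<in>D. \<bar>g b - g a\<bar>) < \<epsilon> / 2"
    using g[unfolded abs_continuous_on_def, rule_format, OF e] by blast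
  obtain \<rho>2 where \<rho>2: "\<rho>2 > 0" "\<And>D. ?P D \<rho>2 \<Longrightarrow> (\<Sum>(a, b)\<in>D. \<bar>h b - h a\<bar>) < \<epsilon> / 2"
    using h[unfolded abs_continuous_on_def, rule_format, OF e] by blast
  have "(\<Sum>(a, b)\<in>D. \<bar>g b + h b - (g a + h a)\<bar>) < \<epsilon>" if D: "?P D (min \<rho>1 \<rho>2)" for D
  proof -
    have "(\<Sum>(a, b)\<in>D. \<bar>g b + h b - (g a + h a)\<bar>)
        \<le> (\<Sum>(a, b)\<in>D. \<bar>g b - g a\<bar> + \<bar>h b - h a\<bar>)"
      by (intro sum_mono) auto
    also have "\<dots> = (\<Sum>(a, b)\<in>D. \<bar>g b - g a\<bar>) + (\<Sum>(a, b)\<in>D. \<bar>h b - h a\<bar>)"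
      by (simp add: case_prod_unfold sum.distrib)
    also have "\<dots> < \<epsilon>" using \<rho>1(2)[of D] \<rho>2(2)[of D] D by simp
    finally show ?thesis .
  qed
  then show "\<exists>\<rho>>0. \<forall>D. ?P D \<rho> \<longrightarrow> (\<Sum>(a, b)\<in>D. \<bar>g b + h b - (g a + h a)\<bar>) < \<epsilon>"
    using \<rho>1(1) \<rho>2(1) by (intro exI[of _ "min \<rho>1 \<rho>2"]) simp
qed

lemma continuous_derivative_imp_lipschitz_on:
  fixes g g' :: "real \<Rightarrow> real"
  assumes "\<And>x. x \<in> {a..b} \<Longrightarrow> (g has_real_derivative g' x) (at x within {a..b})"
    and "continuous_on {a..b} g'"
  obtains L where "L-lipschitz_on {a..b} g"
proof -
  have "bounded (g' ` {a..b})"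
    using assms(2) by (intro compact_imp_bounded compact_continuous_image) auto
  then obtain C where C: "C > 0" "\<And>x. x \<in> {a..b} \<Longrightarrow> \<bar>g' x\<bar> \<le> C"
    by (auto simp: bounded_pos)
  have "C-lipschitz_on {a..b} g"
  proof (rule lipschitz_onI)
    fix x y assume "x \<in> {a..b}" "y \<in> {a..b}"
    then have "norm (g x - g y) \<le> C * norm (x - y)"
      using assms(1) C by (intro field_differentiable_bound[of "{a..b}" g g']) auto
    then show "dist (g x) (g y) \<le> C * dist x y" by (simp add: dist_norm)
  qed (use C in simp)
  then show thesis ..
qed

lemma C1_differentiable_on_real_derivD:
  fixes v :: "real \<Rightarrow> real"
  assumes "v C1_differentiable_on S"
  shows "\<And>t. t \<in> S \<Longrightarrow> (v has_real_derivative deriv v t) (at t)" "continuous_on S (deriv v)"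
proof -
  have v: "\<And>t. t \<in> S \<Longrightarrow> v differentiable at t" "continuous_on S (\<lambda>t. vector_derivative v (at t))"
    using assms by (auto simp: C1_differentiable_on_eq)
  show D: "(v has_real_derivative deriv v t) (at t)" if "t \<in> S" for t
    using v(1)[OF that] by (simp add: real_differentiable_def DERIV_deriv_iff_real_differentiable)
  have "vector_derivative v (at t) = deriv v t" if "t \<in> S" for t
    using D[OF that] by (simp add: has_real_derivative_iff_has_vector_derivative vector_derivative_at)
  then show "continuous_on S (deriv v)" using v(2) by (simp cong: continuous_on_cong)
qed

subsection \<open>Energy estimates\<close>

text \<open>The inverse of \<phi> is \<open>w / sqrt (1 + w\<^sup>2)\<close>, the derivative of
  \<open>sqrt (1 + w\<^sup>2)\<close>. Written in terms of \<open>w = mink_phi \<xi>\<close>, the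
  kinetic energy therefore has \<xi> itself as its derivative.\<close>

lemma sqrt_one_minus_mink_phi:
  assumes "\<bar>\<xi>\<bar> < 1"
  shows "1 / sqrt (1 - \<xi>\<^sup>2) = sqrt (1 + (mink_phi \<xi>)\<^sup>2)"
    and "mink_phi \<xi> / sqrt (1 + (mink_phi \<xi>)\<^sup>2) = \<xi>"
proof -
  have pos: "1 - \<xi>\<^sup>2 > 0" using assms by (simp add: abs_square_less_1)
  then have "1 + (mink_phi \<xi>)\<^sup>2 = 1 / (1 - \<xi>\<^sup>2)"
    by (simp add: mink_phi_def power_divide field_simps)
  then show eq: "1 / sqrt (1 - \<xi>\<^sup>2) = sqrt (1 + (mink_phi \<xi>)\<^sup>2)"
    by (simp add: real_sqrt_divide)
  show "mink_phi \<xi> / sqrt (1 + (mink_phi \<xi>)\<^sup>2) = \<xi>"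
    unfolding eq[symmetric] using pos by (simp add: mink_phi_def)
qed

text \<open>\<open>v''\<close> need not be mentioned: the energy is a smooth function of \<open>\<phi>(v')\<close>.\<close>

lemma kinetic_energy_has_derivative:
  assumes u: "\<And>s. \<bar>u s\<bar> < 1" and w: "((\<lambda>s. mink_phi (u s)) has_real_derivative w') (at t)"
  shows "((\<lambda>s. \<delta> / sqrt (1 - (u s)\<^sup>2)) has_real_derivative \<delta> * w' * u t) (at t)"
proof -
  have pos: "1 + (mink_phi (u t))\<^sup>2 > 0" by (simp add: add_pos_nonneg)
  have "((\<lambda>s. \<delta> * sqrt (1 + (mink_phi (u s))\<^sup>2)) has_real_derivative
      \<delta> * w' * (mink_phi (u t) / sqrt (1 + (mink_phi (u t))\<^sup>2))) (at t)"
    using pos by (auto intro!: derivative_eq_intros w simp: field_simps)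
  moreover have "(\<lambda>s. \<delta> * sqrt (1 + (mink_phi (u s))\<^sup>2)) = (\<lambda>s. \<delta> / sqrt (1 - (u s)\<^sup>2))"
    using sqrt_one_minus_mink_phi(1)[OF u] by (metis mult.right_neutral times_divide_eq_right)
  ultimately show ?thesis using sqrt_one_minus_mink_phi(2)[OF u] by simp
qed

text \<open>The derivative blows up at 1 and -1, so a Lipschitz constant is sought only on a compact
  interval inside the open domain of \<phi>.\<close>

lemma kinetic_energy_lipschitz_on:
  assumes "r < 1"
  obtains L where "L-lipschitz_on {-r..r} (\<lambda>\<xi>. \<delta> / sqrt (1 - \<xi>\<^sup>2))"
proof -
  have pos: "1 - \<xi>\<^sup>2 > 0" if "\<xi> \<in> {-r..r}" for \<xi>
  proof -
    have "\<bar>\<xi>\<bar> < 1" using that assms by auto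
    then show ?thesis by (simp add: abs_square_less_1)
  qed
  show thesis
  proof (rule continuous_derivative_imp_lipschitz_on)
    show "((\<lambda>\<xi>. \<delta> / sqrt (1 - \<xi>\<^sup>2)) has_real_derivative \<delta> * x / (sqrt (1 - x\<^sup>2) * (1 - x\<^sup>2)))
        (at x within {-r..r})" if "x \<in> {-r..r}" for x
      using pos[OF that] by (auto intro!: derivative_eq_intros simp: field_simps)
    show "continuous_on {-r..r} (\<lambda>x. \<delta> * x / (sqrt (1 - x\<^sup>2) * (1 - x\<^sup>2)))"
      using pos by (intro continuous_intros) force+
  qed (rule that)
qed

section \<open>The primitive of \<open>f\<close>, and monotonicity of the energy along a
  solution\<close>

lemma primitive_has_real_derivative:
  assumes "continuous_on {0..1} f" "x \<in> {0..1}"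
  shows "(primitive f has_real_derivative f x) (at x within {0..1})"
  using integral_has_real_derivative[OF assms] by (simp add: primitive_def[abs_def])

lemma continuous_on_primitive:
  assumes "continuous_on {0..1} f"
  shows "continuous_on {0..1} (primitive f)"
  using primitive_has_real_derivative[OF assms] by (rule DERIV_continuous_on)

lemma primitive_has_real_derivative_at:
  assumes "continuous_on {0..1} f" "0 < x" "x < 1"
  shows "(primitive f has_real_derivative f x) (at x)"
proof -
  have "at x within {0..1} = at x"
    using assms by (intro at_within_interior) simp
  then show ?thesis using primitive_has_real_derivative[OF assms(1), of x] assms by simp
qed

text \<open>The factor \<open>deriv v t\<close> of the energy derivative is absent from the sign
  condition because monotonicity makes it nonnegative. Strict monotonicity also keeps
  \<open>v\<close> inside the open unit interval, where the primitive has a two-sided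
  derivative.\<close>

lemma energy_antimono:
  assumes sol: "is_solution \<delta> q f v" and mono: "strict_mono v"
    and f: "continuous_on {0..1} f" and "a \<le> b"
    and sign: "AE t in lebesgue. t \<in> {a<..<b} \<longrightarrow> f (v t) * (K - q t) \<le> 0"
  shows "\<delta> / sqrt (1 - (deriv v b)\<^sup>2) + K * primitive f (v b)
       \<le> \<delta> / sqrt (1 - (deriv v a)\<^sup>2) + K * primitive f (v a)"
proof (rule abs_continuous_on_AE_nonpos_deriv_imp_le[OF _ \<open>a \<le> b\<close>])
  have v01: "v t \<in> {0..1}" for t using sol by (simp add: is_solution_def)
  have v: "v t \<in> {0<..<1}" for t
    using v01[of "t - 1"] v01[of "t + 1"] strict_monoD[OF mono, of "t - 1" t]
      strict_monoD[OF mono, of t "t + 1"] by auto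
  have u: "\<bar>deriv v t\<bar> < 1" for t using sol by (simp add: is_solution_def)
  have C1: "v C1_differentiable_on UNIV" using sol by (simp add: is_solution_def)
  note D = C1_differentiable_on_real_derivD(1)[OF C1, OF UNIV_I]
  note cont = C1_differentiable_on_real_derivD(2)[OF C1]
  have u0: "0 \<le> deriv v t" for t
    using mono by (intro mono_on_imp_deriv_nonneg[OF _ D, of UNIV]) (auto simp: strict_mono_mono)
  show "abs_continuous_on {a..b} (\<lambda>t. \<delta> / sqrt (1 - (deriv v t)\<^sup>2) + K * primitive f (v t))"
  proof (rule abs_continuous_on_add)
    \<comment> \<open>The maximum of \<open>\<bar>deriv v t\<bar>\<close> on the compact interval is
      attained, hence less than 1. So \<open>deriv v\<close> stays in a compact interval on which
      the kinetic energy is Lipschitz.\<close>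
    have "continuous_on {a..b} (\<lambda>t. \<bar>deriv v t\<bar>)"
      by (intro continuous_on_rabs continuous_on_subset[OF cont]) auto
    then obtain s where s: "\<And>t. t \<in> {a..b} \<Longrightarrow> \<bar>deriv v t\<bar> \<le> \<bar>deriv v s\<bar>"
      using continuous_attains_sup[of "{a..b}" "\<lambda>t. \<bar>deriv v t\<bar>"] \<open>a \<le> b\<close>
      by (metis atLeastatMost_empty_iff compact_Icc not_le)
    obtain L where L: "L-lipschitz_on {- \<bar>deriv v s\<bar>..\<bar>deriv v s\<bar>} (\<lambda>\<xi>. \<delta> / sqrt (1 - \<xi>\<^sup>2))"
      using kinetic_energy_lipschitz_on[OF u] .
    have ac: "abs_continuous_on {a..b} (deriv v)"
      using sol by (simp add: is_solution_def locally_abs_continuous_def)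
    have im: "deriv v ` {a..b} \<subseteq> {- \<bar>deriv v s\<bar>..\<bar>deriv v s\<bar>}"
      using s by (fastforce simp: abs_le_iff)
    show "abs_continuous_on {a..b} (\<lambda>t. \<delta> / sqrt (1 - (deriv v t)\<^sup>2))"
      by (rule abs_continuous_on_lipschitz_compose[OF ac L im])
    obtain L1 where L1: "L1-lipschitz_on {a..b} v"
    proof (rule continuous_derivative_imp_lipschitz_on)
      show "(v has_real_derivative deriv v t) (at t within {a..b})" for t
        by (rule has_field_derivative_at_within[OF D])
      show "continuous_on {a..b} (deriv v)" by (rule continuous_on_subset[OF cont]) simp
    qed
    obtain L2 where L2: "L2-lipschitz_on {0..1} (\<lambda>x. K * primitive f x)"
    proof (rule continuous_derivative_imp_lipschitz_on)
      show "((\<lambda>x. K * primitive f x) has_real_derivative K * f x) (at x within {0..1})"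
        if "x \<in> {0..1}" for x
        using DERIV_cmult[OF primitive_has_real_derivative[OF f that]] .
      show "continuous_on {0..1} (\<lambda>x. K * f x)" using f by (intro continuous_intros)
    qed
    show "abs_continuous_on {a..b} (\<lambda>t. K * primitive f (v t))"
      using v01
      by (intro abs_continuous_on_lipschitz_compose[OF lipschitz_imp_abs_continuous_on[OF L1] L2]) auto
  qed

  have "AE t in lebesgue. (\<lambda>s. mink_phi (deriv v s)) field_differentiable (at t) \<and>
        \<delta> * deriv (\<lambda>s. mink_phi (deriv v s)) t + q t * f (v t) = 0"
    using sol by (simp add: is_solution_def)
  with sign show "AE t in lebesgue. t \<in> {a<..<b} \<longrightarrow> (\<exists>D\<le>0.
      ((\<lambda>t. \<delta> / sqrt (1 - (deriv v t)\<^sup>2) + K * primitive f (v t)) has_real_derivative D) (at t))"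
  proof (eventually_elim, intro impI)
    fix t assume t: "t \<in> {a<..<b}" and sgn: "t \<in> {a<..<b} \<longrightarrow> f (v t) * (K - q t) \<le> 0"
      and eq: "(\<lambda>s. mink_phi (deriv v s)) field_differentiable (at t) \<and>
        \<delta> * deriv (\<lambda>s. mink_phi (deriv v s)) t + q t * f (v t) = 0"
    let ?w = "deriv (\<lambda>s. mink_phi (deriv v s)) t"
    have w: "((\<lambda>s. mink_phi (deriv v s)) has_real_derivative ?w) (at t)"
      using eq by (simp add: field_differentiable_derivI)
    have "(primitive f has_real_derivative f (v t)) (at (v t))"
      using v[of t] by (intro primitive_has_real_derivative_at[OF f]) auto
    then have "((\<lambda>t. primitive f (v t)) has_real_derivative f (v t) * deriv v t) (at t)"
      by (rule DERIV_chain2) (rule D)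
    then have "((\<lambda>t. \<delta> / sqrt (1 - (deriv v t)\<^sup>2) + K * primitive f (v t)) has_real_derivative
        \<delta> * ?w * deriv v t + K * (f (v t) * deriv v t)) (at t)"
      by (intro DERIV_add DERIV_cmult kinetic_energy_has_derivative u w)
    \<comment> \<open>The differential equation replaces \<delta> times the derivative of
      \<open>\<phi>(v')\<close> by \<open>- q t * f (v t)\<close>.\<close>
    moreover have "\<delta> * ?w * deriv v t + K * (f (v t) * deriv v t) = f (v t) * (K - q t) * deriv v t"
    proof -
      have "\<delta> * ?w = - (q t * f (v t))" using eq by linarith
      then show ?thesis by (simp add: algebra_simps)
    qed
    moreover have "f (v t) * (K - q t) * deriv v t \<le> 0"
      using sgn t u0[of t] mult_nonpos_nonneg[of "f (v t) * (K - q t)" "deriv v t"] by blast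
    ultimately show "\<exists>D\<le>0. ((\<lambda>t. \<delta> / sqrt (1 - (deriv v t)\<^sup>2) + K * primitive f (v t))
        has_real_derivative D) (at t)" by metis
  qed
qed

text \<open>The mean value theorem on the intervals from \<open>- n - 1\<close> to
  \<open>- n\<close> realises the increments of \<open>v\<close>, which tend to 0, as values of the
  derivative.\<close>

lemma has_real_derivative_vanishing_sequence_at_bot:
  fixes v :: "real \<Rightarrow> real"
  assumes der: "\<And>t. (v has_real_derivative v' t) (at t)" and lim: "(v \<longlongrightarrow> l) at_bot"
  obtains s :: "nat \<Rightarrow> real" where "filterlim s at_bot sequentially" "(\<lambda>n. v' (s n)) \<longlonglongrightarrow> 0"
proof -
  have "\<exists>z. - real n - 1 < z \<and> z < - real n \<and> v (- real n) - v (- real n - 1) = v' z" for n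
    using MVT2[of "- real n - 1" "- real n" v v'] der by auto
  then obtain s where s: "\<And>n. - real n - 1 < s n" "\<And>n. s n < - real n"
    "\<And>n. v (- real n) - v (- real n - 1) = v' (s n)" by metis
  have lim_bot: "filterlim (\<lambda>n. - real n) at_bot sequentially"
    using filterlim_real_sequentially by (simp add: filterlim_uminus_at_bot)
  have lim_bot1: "filterlim (\<lambda>n. - real n - 1) at_bot sequentially"
    by (rule filterlim_at_bot_mono[OF lim_bot]) simp
  have "filterlim s at_bot sequentially"
    unfolding filterlim_at_bot
  proof
    fix Z
    from lim_bot have "eventually (\<lambda>n. - real n \<le> Z) sequentially"
      by (simp add: filterlim_at_bot)
    then show "eventually (\<lambda>n. s n \<le> Z) sequentially"
      by eventually_elim (use s(2) in \<open>meson less_imp_le order_trans\<close>)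
  qed
  moreover have "(\<lambda>n. v (- real n) - v (- real n - 1)) \<longlonglongrightarrow> l - l"
    by (intro tendsto_diff filterlim_compose[OF lim] lim_bot lim_bot1)
  ultimately show thesis using s(3) by (intro that) auto
qed

lemma primitive_tendsto:
  assumes "continuous_on {0..1} f" "l \<in> {0..1}" "(x \<longlongrightarrow> l) G" "\<And>n. x n \<in> {0..1}"
  shows "((\<lambda>n. primitive f (x n)) \<longlongrightarrow> primitive f l) G"
proof (rule continuous_on_tendsto_compose[of "{0..1}" "primitive f"])
  show "continuous_on {0..1} (primitive f)" by (rule continuous_on_primitive[OF assms(1)])
qed (use assms in auto)

lemma primitive_mono_of_nonneg:
  assumes f: "continuous_on {0..1} f" and "0 \<le> a" "a \<le> b" "b \<le> 1"
    and "\<And>s. a < s \<Longrightarrow> s < b \<Longrightarrow> 0 \<le> f s"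
  shows "primitive f a \<le> primitive f b"
proof (rule DERIV_nonneg_imp_increasing_open[OF \<open>a \<le> b\<close>])
  show "\<exists>y. (primitive f has_real_derivative y) (at x) \<and> 0 \<le> y" if "a < x" "x < b" for x
    using primitive_has_real_derivative_at[OF f, of x] assms that by auto
  show "continuous_on {a..b} (primitive f)"
    using assms by (intro continuous_on_subset[OF continuous_on_primitive[OF f]]) auto
qed

lemma primitive_antimono_of_nonpos:
  assumes f: "continuous_on {0..1} f" and "0 \<le> a" "a \<le> b" "b \<le> 1"
    and "\<And>s. a < s \<Longrightarrow> s < b \<Longrightarrow> f s \<le> 0"
  shows "primitive f b \<le> primitive f a"
  using primitive_mono_of_nonneg[of "\<lambda>s. - f s" a b] assms
  by (simp add: primitive_def continuous_on_minus)

text \<open>\<open>real_of_ereal\<close> sends both infinities to 0, so finiteness must be checked: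
  \<open>in_Linf\<close> excludes the upper one, and lying above some \<open>\<bar>g x\<bar>\<close>
  excludes the lower one.\<close>

lemma Linf_norm_bound:
  assumes "in_Linf M g"
  shows "AE x in M. \<bar>g x\<bar> \<le> Linf_norm M g"
  using esssup_AE[of "\<lambda>x. ereal \<bar>g x\<bar>" M]
proof eventually_elim
  case (elim x)
  have "esssup M (\<lambda>x. ereal \<bar>g x\<bar>) \<noteq> \<infinity>" using assms by (simp add: in_Linf_def)
  moreover have "esssup M (\<lambda>x. ereal \<bar>g x\<bar>) \<noteq> -\<infinity>" using elim by auto
  ultimately show ?case
    using elim by (cases "esssup M (\<lambda>x. ereal \<bar>g x\<bar>)") (auto simp: Linf_norm_def)
qed

text \<open>As \<open>v\<close> is bounded, \<open>v'\<close> vanishes along a sequence tending to \<open>-\<infinity>\<close>.\<close>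

lemma energy_left_bound:
  assumes het: "heteroclinic_solution \<delta> q f v" and f: "continuous_on {0..1} f"
    and sign: "AE t in lebesgue. t < b \<longrightarrow> f (v t) * (K - q t) \<le> 0"
  shows "\<delta> / sqrt (1 - (deriv v b)\<^sup>2) + K * primitive f (v b) \<le> \<delta>"
proof -
  have sol: "is_solution \<delta> q f v" and mono: "strict_mono v" and lim: "(v \<longlongrightarrow> 0) at_bot"
    using het by (auto simp: heteroclinic_solution_def)
  have v: "v t \<in> {0..1}" for t using sol by (simp add: is_solution_def)
  obtain s where s: "filterlim s at_bot sequentially" "(\<lambda>n. deriv v (s n)) \<longlonglongrightarrow> 0"
    using has_real_derivative_vanishing_sequence_at_bot[OF _ lim, of "deriv v"]
      C1_differentiable_on_real_derivD(1)[of v UNIV] sol by (auto simp: is_solution_def)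
  have "(\<lambda>n. primitive f (v (s n))) \<longlonglongrightarrow> primitive f 0"
    using v by (intro primitive_tendsto[OF f] filterlim_compose[OF lim s(1)]) auto
  \<comment> \<open>Along the sequence both \<open>deriv v\<close> and
    \<open>primitive f (v t)\<close> tend to 0, leaving the rest energy \<delta>.\<close>
  then have "(\<lambda>n. \<delta> / sqrt (1 - (deriv v (s n))\<^sup>2) + K * primitive f (v (s n)))
      \<longlonglongrightarrow> \<delta> / sqrt (1 - 0\<^sup>2) + K * primitive f 0"
    by (intro tendsto_intros s) auto
  then have "(\<lambda>n. \<delta> / sqrt (1 - (deriv v (s n))\<^sup>2) + K * primitive f (v (s n))) \<longlonglongrightarrow> \<delta>"
    by (simp add: primitive_def)
  then show ?thesis
  proof (rule tendsto_lowerbound)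
    have "eventually (\<lambda>n. s n \<le> b) sequentially"
      using s(1) by (simp add: filterlim_at_bot)
    then show "eventually (\<lambda>n. \<delta> / sqrt (1 - (deriv v b)\<^sup>2) + K * primitive f (v b)
        \<le> \<delta> / sqrt (1 - (deriv v (s n))\<^sup>2) + K * primitive f (v (s n))) sequentially"
    proof eventually_elim
      case (elim n)
      show ?case
        by (rule energy_antimono[OF sol mono f elim]) (use sign in eventually_elim, auto)
    qed
  qed simp
qed

text \<open>Here only a lower bound for the energy at infinity is wanted. The kinetic term is always
  at least \<delta>, so no sequence with vanishing derivative has to be chosen.\<close>

lemma energy_right_bound:
  assumes het: "heteroclinic_solution \<delta> q f v" and f: "continuous_on {0..1} f" and "\<delta> \<ge> 0"
    and sign: "AE t in lebesgue. a < t \<longrightarrow> f (v t) * (K - q t) \<le> 0"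
  shows "\<delta> + K * primitive f 1 \<le> \<delta> / sqrt (1 - (deriv v a)\<^sup>2) + K * primitive f (v a)"
proof -
  have sol: "is_solution \<delta> q f v" and mono: "strict_mono v" and lim: "(v \<longlongrightarrow> 1) at_top"
    using het by (auto simp: heteroclinic_solution_def)
  have v: "v t \<in> {0..1}" for t using sol by (simp add: is_solution_def)
  have "((\<lambda>t. \<delta> + K * primitive f (v t)) \<longlongrightarrow> \<delta> + K * primitive f 1) at_top"
    using v by (intro tendsto_intros primitive_tendsto[OF f _ lim]) auto
  then show ?thesis
  proof (rule tendsto_upperbound)
    show "eventually (\<lambda>t. \<delta> + K * primitive f (v t)
        \<le> \<delta> / sqrt (1 - (deriv v a)\<^sup>2) + K * primitive f (v a)) at_top"
      using eventually_ge_at_top[of a]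
    proof eventually_elim
      case (elim t)
      have "\<bar>deriv v t\<bar> < 1" using sol by (simp add: is_solution_def)
      then have "0 < sqrt (1 - (deriv v t)\<^sup>2)" "sqrt (1 - (deriv v t)\<^sup>2) \<le> 1"
        by (simp_all add: abs_square_less_1)
      then have "\<delta> \<le> \<delta> / sqrt (1 - (deriv v t)\<^sup>2)"
        using \<open>\<delta> \<ge> 0\<close> by (simp add: le_divide_eq mult_left_le)
      moreover have "\<delta> / sqrt (1 - (deriv v t)\<^sup>2) + K * primitive f (v t)
          \<le> \<delta> / sqrt (1 - (deriv v a)\<^sup>2) + K * primitive f (v a)"
        by (rule energy_antimono[OF sol mono f elim]) (use sign in eventually_elim, auto)
      ultimately show ?case by linarith
    qed
  qed simp
qed

section \<open>Nonexistence, by comparing at \<open>t\<^sub>0\<close> the energies coming from both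
  ends\<close>

theorem theorem3p9:
  fixes \<delta> t\<^sub>0 \<eta> c \<alpha> :: real
    and q f F :: "real \<Rightarrow> real"
  assumes "\<delta> > 0"
    and "in_Linf (lebesgue_on {..<t\<^sub>0}) q"
    and "\<eta> > 0"
    and "AE t in lebesgue_on {..<t\<^sub>0}. q t \<ge> \<eta>"
    and "c > 0"
    and "\<forall>t\<ge>t\<^sub>0. q t = c"
    and "\<exists>L. L-lipschitz_on {0..1} f"
    and "f 0 = 0" and "f 1 = 0"
    and "\<alpha> \<in> {0<..<1}" and "f \<alpha> = 0"
    and "\<forall>s\<in>{0<..<\<alpha>}. f s < 0"
    and "\<forall>s\<in>{\<alpha><..<1}. f s > 0"
    and "F = primitive f"
    and "F 1 > 0"
    and "\<eta> > Linf_norm (lebesgue_on {..<t\<^sub>0}) q * (- F \<alpha> / (F 1 - F \<alpha>))"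
    and "c > Linf_norm (lebesgue_on {..<t\<^sub>0}) q * (- F \<alpha> / (F 1 - F \<alpha>))"
  shows "\<not> (\<exists>v. heteroclinic_solution \<delta> q f v)"
proof
  assume "\<exists>v. heteroclinic_solution \<delta> q f v"
  then obtain v where het: "heteroclinic_solution \<delta> q f v" by blast
  then have sol: "is_solution \<delta> q f v" and mono: "strict_mono v"
    and lim0: "(v \<longlongrightarrow> 0) at_bot"
    by (auto simp: heteroclinic_solution_def)
  have v01: "v t \<in> {0..1}" for t using sol by (simp add: is_solution_def)
  have f: "continuous_on {0..1} f" using assms(7) lipschitz_on_continuous_on by blast
  have fneg: "f s \<le> 0" if "0 \<le> s" "s \<le> \<alpha>" for s
    using that assms(8,11,12) by (cases "s = 0 \<or> s = \<alpha>") (auto intro: less_imp_le)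
  have fpos: "0 \<le> f s" if "\<alpha> \<le> s" "s \<le> 1" for s
    using that assms(9,11,13) by (cases "s = 1 \<or> s = \<alpha>") (auto intro: less_imp_le)
  define M where "M = Linf_norm (lebesgue_on {..<t\<^sub>0}) q"
  have "AE t in lebesgue_on {..<t\<^sub>0}. \<eta> \<le> q t \<and> q t \<le> M"
    using assms(4) Linf_norm_bound[OF assms(2)] unfolding M_def by eventually_elim auto
  then have q: "AE t in lebesgue. t < t\<^sub>0 \<longrightarrow> \<eta> \<le> q t \<and> q t \<le> M"
    by (subst (asm) AE_restrict_space_iff) auto
  \<comment> \<open>Otherwise \<open>\<eta> \<le> q t \<le> M < 0\<close> would contradict
    \<open>\<eta> > 0\<close> at almost every \<open>t < t\<^sub>0\<close>, forcing that half-line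
    to be null although it contains an interval of length 1.\<close>
  have "M \<ge> 0"
  proof (rule ccontr)
    assume "\<not> M \<ge> 0"
    then have "AE t in lebesgue. \<not> t < t\<^sub>0"
      using q \<open>\<eta> > 0\<close> by (auto elim!: eventually_mono)
    then have "emeasure lebesgue {..<t\<^sub>0} = 0"
      by (subst (asm) AE_iff_measurable[of "{..<t\<^sub>0}"]) auto
    moreover have "emeasure lebesgue {t\<^sub>0 - 1<..<t\<^sub>0} \<le> emeasure lebesgue {..<t\<^sub>0}"
      by (intro emeasure_mono) auto
    ultimately show False by simp
  qed

  have F0: "F 0 = 0" by (simp add: assms(14) primitive_def)
  have Fdec: "F y \<le> F x" if "0 \<le> x" "x \<le> y" "y \<le> \<alpha>" for x y
    unfolding assms(14) using that fneg assms(10) by (intro primitive_antimono_of_nonpos[OF f]) auto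
  have Finc: "F x \<le> F y" if "\<alpha> \<le> x" "x \<le> y" "y \<le> 1" for x y
    unfolding assms(14) using that fpos assms(10) by (intro primitive_mono_of_nonneg[OF f]) auto
  have F\<alpha>: "F \<alpha> \<le> 0" using Fdec[of 0 \<alpha>] F0 assms(10) by simp
  \<comment> \<open>\<open>m\<close> is the common lower bound in the hypotheses on \<eta> and
    \<open>c\<close>.\<close>
  define m where "m = M * (- F \<alpha> / (F 1 - F \<alpha>))"
  have m: "m * (F 1 - F \<alpha>) = - M * F \<alpha>" "m < \<eta>" "m < c"
    using F\<alpha> assms(15-17) by (auto simp: m_def M_def)

  define E where "E = (\<lambda>t. \<delta> / sqrt (1 - (deriv v t)\<^sup>2))"
  \<comment> \<open>With \<open>K = c\<close> the factor \<open>K - q t\<close> vanishes to the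
    right of \<open>t\<^sub>0\<close>, so the sign condition is trivial.\<close>
  have right: "\<delta> + c * F 1 \<le> E t\<^sub>0 + c * F (v t\<^sub>0)"
    unfolding E_def assms(14)
    by (rule energy_right_bound[OF het f]) (use assms(1,6) in auto)
  \<comment> \<open>Stated for a general \<open>s\<close>: it is used at \<open>t\<^sub>0\<close> in
    the first case and at the time when \<open>v\<close> reaches \<alpha> in the second.\<close>
  have left: "E s + M * F (v s) \<le> \<delta>" if "s \<le> t\<^sub>0" "v s \<le> \<alpha>" for s
    unfolding E_def assms(14)
  proof (rule energy_left_bound[OF het f])
    show "AE t in lebesgue. t < s \<longrightarrow> f (v t) * (M - q t) \<le> 0"
      using q
    proof (eventually_elim, intro impI)
      fix t assume "t < s" and qt: "t < t\<^sub>0 \<longrightarrow> \<eta> \<le> q t \<and> q t \<le> M"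
      then have "v t < v s" using strict_monoD[OF mono] by blast
      then have "f (v t) \<le> 0" using fneg v01[of t] that(2) by simp
      then show "f (v t) * (M - q t) \<le> 0"
        using qt \<open>t < s\<close> that(1) by (intro mult_nonpos_nonneg) auto
    qed
  qed

  show False
  proof (cases "v t\<^sub>0 \<le> \<alpha>")
    case True
    let ?F = "F (v t\<^sub>0)"
    have FF: "F \<alpha> \<le> ?F" "?F \<le> 0"
      using Fdec[of "v t\<^sub>0" \<alpha>] Fdec[of 0 "v t\<^sub>0"] True v01[of "t\<^sub>0"] F0 by auto
    have "c * (F 1 - ?F) \<le> - M * ?F"
      using left[OF order_refl True] right by (simp add: algebra_simps)
    moreover have "m * (F 1 - ?F) < c * (F 1 - ?F)"
      using m(3) FF assms(15) by (intro mult_strict_right_mono) auto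
    \<comment> \<open>Multiplying by \<open>F 1 - F \<alpha>\<close> clears the denominator of
      \<open>m\<close>. The products \<open>M * F \<alpha> * ?F\<close> then cancel, and what
      remains contradicts \<open>F \<alpha> \<le> ?F\<close>.\<close>
    ultimately have "m * (F 1 - ?F) * (F 1 - F \<alpha>) < - M * ?F * (F 1 - F \<alpha>)"
      using F\<alpha> assms(15) by (intro mult_strict_right_mono) auto
    moreover have "m * (F 1 - ?F) * (F 1 - F \<alpha>) = - M * F \<alpha> * (F 1 - ?F)"
      unfolding m(1)[symmetric] by simp
    ultimately have "M * F 1 * ?F < M * F 1 * F \<alpha>" by (simp add: algebra_simps)
    moreover have "M * F 1 * F \<alpha> \<le> M * F 1 * ?F"
      using FF \<open>M \<ge> 0\<close> assms(15) by (intro mult_left_mono) auto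
    ultimately show False by linarith
  next
    case False
    \<comment> \<open>A point with \<open>v a < \<alpha>\<close> is needed for the intermediate
      value theorem, which yields the crossing time \<open>s\<close>.\<close>
    obtain a where a: "a \<le> t\<^sub>0" "v a < \<alpha>"
    proof -
      have "eventually (\<lambda>t. v t < \<alpha>) at_bot" using order_tendstoD(2)[OF lim0] assms(10) by simp
      then have "eventually (\<lambda>t. v t < \<alpha> \<and> t \<le> t\<^sub>0) at_bot"
        using eventually_le_at_bot[of t\<^sub>0] by eventually_elim simp
      then show thesis using that eventually_happens'[OF trivial_limit_at_bot_linorder] by blast
    qed
    have "continuous_on {a..t\<^sub>0} v"
      using sol C1_differentiable_imp_continuous_on continuous_on_subset
      by (metis is_solution_def subset_UNIV)
    then obtain s where s: "s \<le> t\<^sub>0" "v s = \<alpha>"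
      using IVT'[of v a \<alpha> t\<^sub>0] a False by auto
    have "E t\<^sub>0 + \<eta> * F (v t\<^sub>0) \<le> E s + \<eta> * F (v s)"
      unfolding E_def assms(14)
    proof (rule energy_antimono[OF sol mono f s(1)])
      show "AE t in lebesgue. t \<in> {s<..<t\<^sub>0} \<longrightarrow> f (v t) * (\<eta> - q t) \<le> 0"
        using q
      proof (eventually_elim, intro impI)
        fix t assume t: "t \<in> {s<..<t\<^sub>0}" and qt: "t < t\<^sub>0 \<longrightarrow> \<eta> \<le> q t \<and> q t \<le> M"
        then have "v s < v t" using strict_monoD[OF mono] by simp
        then have "0 \<le> f (v t)" using fpos v01[of t] s(2) by simp
        then show "f (v t) * (\<eta> - q t) \<le> 0"
          using qt t by (intro mult_nonneg_nonpos) auto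
      qed
    qed
    moreover have "E s + M * F \<alpha> \<le> \<delta>" using left[of s] s by simp
    \<comment> \<open>Sum of three estimates: from \<open>t\<^sub>0\<close> to infinity, from
      \<open>s\<close> to \<open>t\<^sub>0\<close>, and from minus infinity to \<open>s\<close>. The
      kinetic terms \<open>E t\<^sub>0\<close> and \<open>E s\<close> cancel.\<close>
    ultimately have *: "c * (F 1 - F (v t\<^sub>0)) + \<eta> * (F (v t\<^sub>0) - F \<alpha>) \<le> m * (F 1 - F \<alpha>)"
      using right s(2) unfolding m(1) by (simp add: algebra_simps)
    have FF: "F \<alpha> \<le> F (v t\<^sub>0)" "F (v t\<^sub>0) \<le> F 1"
      using Finc[of \<alpha> "v t\<^sub>0"] Finc[of "v t\<^sub>0" 1] v01[of "t\<^sub>0"] False by auto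
    \<comment> \<open>With one coefficient for both differences, \<open>F (v t\<^sub>0)\<close>
      telescopes away; the minimum is still larger than \<open>m\<close>.\<close>
    define k where "k = min c \<eta>"
    have "k * (F 1 - F (v t\<^sub>0)) + k * (F (v t\<^sub>0) - F \<alpha>)
        \<le> c * (F 1 - F (v t\<^sub>0)) + \<eta> * (F (v t\<^sub>0) - F \<alpha>)"
      using FF by (intro add_mono mult_right_mono) (auto simp: k_def)
    with * have "k * (F 1 - F \<alpha>) \<le> m * (F 1 - F \<alpha>)" by (simp add: algebra_simps)
    moreover have "m * (F 1 - F \<alpha>) < k * (F 1 - F \<alpha>)"
      using m F\<alpha> assms(15) by (intro mult_strict_right_mono) (auto simp: k_def)
    ultimately show False by linarith
  qed
qed

end
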